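(* Let $\boldsymbol{\varphi}^{(j)}(t)=[\varphi^{(j)}_1(t),\dots,\varphi^{(j)}_{r_j}(t)]$ and $\boldsymbol{\varphi}^{(j+1,\dots,d)}(t)=[\varphi^{(j+1,\dots,d)}_1(t),\dots,\varphi^{(j+1,\dots,d)}_{r_j}(t)]$ (row vectors) be the bi-orthogonal (BO) modes at the $j$th level of the Tensor Train binary tree. Define $$\boldsymbol{\psi}^{(j)}(t)=\boldsymbol{\varphi}^{(j)}(t)\,\boldsymbol{\Lambda}_j^{-1/2}(t)\,\boldsymbol{P}_j(t),\qquad \boldsymbol{\psi}^{(j+1,\dots,d)}(t)=\boldsymbol{\varphi}^{(j+1,\dots,d)}(t)\,\boldsymbol{\Lambda}_j^{1/2}(t)\,\boldsymbol{P}_j(t),$$ where $[\boldsymbol{\Lambda}_j(t)]_{ik}=\langle\varphi^{(j)}_i,\varphi^{(j)}_k\rangle$ and $\boldsymbol{P}_j(t)$ is the real $r_j\times r_j$ matrix solving $$\frac{d\boldsymbol{P}_j}{dt}=-\boldsymbol{\Lambda}_j^{-1/2}\boldsymbol{\Sigma}_j\boldsymbol{\Lambda}_j^{-1/2}\boldsymbol{P}_j,\qquad \boldsymbol{P}_j(0)=\boldsymbol{I},$$ with $[\boldsymbol{\Sigma}_j(t)]_{ik}=\langle\varphi^{(j)}_i,\partial\varphi^{(j)}_k/\partial t\rangle$ for $i\neq k$ and $[\boldsymbol{\Sigma}_j(t)]_{ii}=0$. Then this linear transformation is invertible, and it defines a new set of modes $\{\psi^{(j)}_1(t),\dots,\psi^{(j)}_{r_j}(t)\}$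 (the entries of $\boldsymbol{\psi}^{(j)}(t)$) such that, for all $t\ge 0$: (i) $\{\psi^{(j)}_1,\dots,\psi^{(j)}_{r_j}\}$ is orthonormal; (ii) $\displaystyle\sum_{k=1}^{r_j}\psi^{(j)}_k(t)\,\psi^{(j+1,\dots,d)}_k(t)=\sum_{k=1}^{r_j}\varphi^{(j)}_k(t)\,\varphi^{(j+1,\dots,d)}_k(t)$; (iii) $\{\psi^{(j)}_1,\dots,\psi^{(j)}_{r_j}\}$ satisfies the dynamic orthogonality (DO) condition $\displaystyle\left\langle\frac{\partial\psi^{(j)}_i}{\partial t},\psi^{(j)}_k\right\rangle=0$ for all $i,k=1,\dots,r_j$.
   Context: $\langle\cdot,\cdot\rangle$ denotes the $L^2$ inner product over all spatial variables on which the two arguments are defined. The superscript $(j)$ means that a function depends on the spatial variable $x_j\in\Omega^{(j)}$ (a one-dimensional domain), and $(j+1,\dots,d)$ that it depends on $(x_{j+1},\dots,x_d)\in\Omega^{(j+1)}\times\cdots\times\Omega^{(d)}$; all functions also depend on time $t\ge 0$ and spatial arguments are omitted. The BO modes at level $j$ (for a fixed multi-index $(i_1,\dots,i_{j-1})$ of the preceding levels, suppressed in the notation), with $r_j$ finite, are real-valued functions $\varphi^{(j)}_k(t)\in L^2(\Omega^{(j)})$ and $\varphi^{(j+1,\dots,d)}_k(t)\in L^2(\Omega^{(j+1)}\times\cdots\times\Omega^{(d)})$, $k=1,\dots,r_j$, satisfying for all $t\ge 0$ the bi-orthogonality conditions $$\langle\varphi^{(j)}_k(t),\varphi^{(j)}_p(t)\rangle=\lambda_k(t)\,\delta_{kp},\qquad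 \langle\varphi^{(j+1,\dots,d)}_k(t),\varphi^{(j+1,\dots,d)}_p(t)\rangle=\delta_{kp}.$$ Hence $\boldsymbol{\Lambda}_j(t)$ is diagonal with diagonal entries $\lambda_k(t)$. It is assumed that $\lambda_k(t)>0$ for all $k$ and $t\ge0$, so that $\boldsymbol{\Lambda}_j^{\pm1/2}(t)$ are defined, and that the modes are continuously differentiable in $t$ (as $L^2$-valued functions). *)

theory Defs
  imports "HOL-Analysis.Analysis"
begin

text \<open>
  Elements of \<open>L\<^sup>2(M)\<close> are handled through representatives: measurable, square-integrable
  functions. No quotient by equality almost everywhere is taken.
\<close>

definition L2 :: "'a measure \<Rightarrow> ('a \<Rightarrow> real) set" where
  "L2 M = {f \<in> borel_measurable M. integrable M (\<lambda>x. (f x)\<^sup>2)}"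

definition L2_inner :: "'a measure \<Rightarrow> ('a \<Rightarrow> real) \<Rightarrow> ('a \<Rightarrow> real) \<Rightarrow> real" where
  "L2_inner M f g = (\<integral>x. f x * g x \<partial>M)"

definition L2_norm :: "'a measure \<Rightarrow> ('a \<Rightarrow> real) \<Rightarrow> real" where
  "L2_norm M f = sqrt (L2_inner M f f)"

definition L2_continuous_on ::
    "'a measure \<Rightarrow> real set \<Rightarrow> (real \<Rightarrow> 'a \<Rightarrow> real) \<Rightarrow> bool" where
  "L2_continuous_on M T u \<longleftrightarrow>
     (\<forall>t\<in>T. u t \<in> L2 M) \<and>
     (\<forall>t\<in>T. ((\<lambda>s. L2_norm M (\<lambda>x. u s x - u t x)) \<longlongrightarrow> 0) (at t within T))"

text \<open>\<open>v\<close> is the derivative at time \<open>t\<close>, relative to the time set \<open>T\<close>, of the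
  \<open>L\<^sup>2(M)\<close>-valued function \<open>u\<close>: the difference quotients converge to \<open>v\<close> in norm.\<close>

definition has_L2_derivative ::
    "'a measure \<Rightarrow> real set \<Rightarrow> (real \<Rightarrow> 'a \<Rightarrow> real) \<Rightarrow> ('a \<Rightarrow> real) \<Rightarrow> real \<Rightarrow> bool" where
  "has_L2_derivative M T u v t \<longleftrightarrow>
     (\<forall>s\<in>T. u s \<in> L2 M) \<and> v \<in> L2 M \<and>
     ((\<lambda>s. L2_norm M (\<lambda>x. (u s x - u t x) / (s - t) - v x)) \<longlongrightarrow> 0) (at t within T)"

definition L2_differentiable ::
    "'a measure \<Rightarrow> real set \<Rightarrow> (real \<Rightarrow> 'a \<Rightarrow> real) \<Rightarrow> real \<Rightarrow> bool" where
  "L2_differentiable M T u t \<longleftrightarrow> (\<exists>v. has_L2_derivative M T u v t)"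

text \<open>The derivative is determined only up to equality almost everywhere (for \<open>t\<close> a limit
  point of \<open>T\<close>); the choice of representative does not affect inner products and norms.\<close>

definition L2_deriv ::
    "'a measure \<Rightarrow> real set \<Rightarrow> (real \<Rightarrow> 'a \<Rightarrow> real) \<Rightarrow> real \<Rightarrow> 'a \<Rightarrow> real" where
  "L2_deriv M T u t = (SOME v. has_L2_derivative M T u v t)"

definition L2_C1_on ::
    "'a measure \<Rightarrow> real set \<Rightarrow> (real \<Rightarrow> 'a \<Rightarrow> real) \<Rightarrow> bool" where
  "L2_C1_on M T u \<longleftrightarrow>
     (\<forall>t\<in>T. L2_differentiable M T u t) \<and> L2_continuous_on M T (L2_deriv M T u)"

definition L2_orthonormal :: "'a measure \<Rightarrow> ('r \<Rightarrow> 'a \<Rightarrow> real) \<Rightarrow> bool" where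
  "L2_orthonormal M f \<longleftrightarrow>
     (\<forall>k. f k \<in> L2 M) \<and> (\<forall>k p. L2_inner M (f k) (f p) = (if k = p then 1 else 0))"

text \<open>Lebesgue measure on \<open>\<Omega>\<^sup>(\<^sup>i\<^sup>)\<close>, and on the product of
  \<open>\<Omega>\<^sup>(\<^sup>i\<^sup>)\<close> for \<open>j < i \<le> d\<close>, whose points are functions on \<open>{j+1..d}\<close>.\<close>

definition domain_measure :: "(nat \<Rightarrow> real set) \<Rightarrow> nat \<Rightarrow> real measure" where
  "domain_measure \<Omega> i = restrict_space lborel (\<Omega> i)"

definition tail_measure :: "(nat \<Rightarrow> real set) \<Rightarrow> nat \<Rightarrow> nat \<Rightarrow> (nat \<Rightarrow> real) measure" where
  "tail_measure \<Omega> j d = (\<Pi>\<^sub>M i\<in>{j+1..d}. domain_measure \<Omega> i)"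

definition gram_matrix :: "'a measure \<Rightarrow> ('r::finite \<Rightarrow> 'a \<Rightarrow> real) \<Rightarrow> real ^ 'r ^ 'r" where
  "gram_matrix M f = (\<chi> i k. L2_inner M (f i) (f k))"

text \<open>The modes are indexed mode first, then time, then space. Time ranges over
  \<open>t \<ge> 0\<close>, so the derivative at \<open>t = 0\<close> is one-sided.\<close>

definition sigma_matrix ::
    "'a measure \<Rightarrow> ('r::finite \<Rightarrow> real \<Rightarrow> 'a \<Rightarrow> real) \<Rightarrow> real \<Rightarrow> real ^ 'r ^ 'r" where
  "sigma_matrix M \<phi> t =
     (\<chi> i k. if i = k then 0 else L2_inner M (\<phi> i t) (L2_deriv M {0..} (\<phi> k) t))"

text \<open>The real power \<open>A\<^sup>s\<close>; meaningful only if \<open>A\<close> is diagonal with positive diagonal entries.\<close>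

definition diag_powr :: "real ^ 'r ^ 'r \<Rightarrow> real \<Rightarrow> real ^ 'r ^ 'r" where
  "diag_powr A s = (\<chi> i k. if i = k then (A $ i $ i) powr s else 0)"

text \<open>The \<open>k\<close>-th entry of the row vector \<open>[f\<^sub>1, \<dots>, f\<^sub>r] A\<close>.\<close>

definition row_times :: "('r::finite \<Rightarrow> 'a \<Rightarrow> real) \<Rightarrow> real ^ 'r ^ 'r \<Rightarrow> 'r \<Rightarrow> 'a \<Rightarrow> real" where
  "row_times f A k = (\<lambda>x. \<Sum>i\<in>UNIV. f i x * A $ i $ k)"

end

theory Submission imports Defs begin

text \<open>
  Write \<open>C = \<Lambda>\<^sup>-\<^sup>1\<^sup>/\<^sup>2 P\<close>, so that \<open>\<psi>\<^sub>k = \<Sum>\<^sub>i C\<^sub>i\<^sub>k \<phi>\<^sub>i\<close>, and let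
  \<open>b\<^sub>m\<^sub>i = \<langle>\<phi>\<^sub>m, \<phi>\<^sub>i'\<rangle>\<close>. Everything rests on two facts about \<open>P\<close> and \<open>C\<close>.

  First, \<open>P(t)\<close> is an orthogonal matrix. Differentiating \<open>\<langle>\<phi>\<^sub>i, \<phi>\<^sub>k\<rangle> = 0\<close> for \<open>i \<noteq> k\<close> shows that
  the matrix \<open>S\<close> of off-diagonal entries of \<open>b\<close> is skew-symmetric, hence so is the generator
  \<open>\<Lambda>\<^sup>-\<^sup>1\<^sup>/\<^sup>2 S \<Lambda>\<^sup>-\<^sup>1\<^sup>/\<^sup>2\<close>, and the flow of a skew-symmetric generator preserves \<open>P\<^sup>T P = I\<close>
  (\<open>skew_flow_orthogonal_matrix\<close>). Invertibility is immediate; orthonormality is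
  \<open>C\<^sup>T \<Lambda> C = P\<^sup>T P = I\<close>; and the expansion is preserved because
  \<open>\<Lambda>\<^sup>-\<^sup>1\<^sup>/\<^sup>2 P (\<Lambda>\<^sup>1\<^sup>/\<^sup>2 P)\<^sup>T = \<Lambda>\<^sup>-\<^sup>1\<^sup>/\<^sup>2 P P\<^sup>T \<Lambda>\<^sup>1\<^sup>/\<^sup>2 = I\<close>.

  Second, \<open>\<lambda>\<^sub>m C\<^sub>m\<^sub>k' = - \<Sum>\<^sub>i b\<^sub>m\<^sub>i C\<^sub>i\<^sub>k\<close>. The differential equation for \<open>P\<close> supplies the terms
  \<open>i \<noteq> m\<close>, while \<open>\<lambda>\<^sub>m' = 2 b\<^sub>m\<^sub>m\<close> makes the derivative of \<open>\<lambda>\<^sub>m\<^sup>-\<^sup>1\<^sup>/\<^sup>2\<close> supply exactly the term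
  \<open>i = m\<close>. By the product rule \<open>\<psi>\<^sub>k' = \<Sum>\<^sub>i (C\<^sub>i\<^sub>k \<phi>\<^sub>i' + C\<^sub>i\<^sub>k' \<phi>\<^sub>i)\<close>, so the identity says that
  \<open>\<langle>\<phi>\<^sub>m, \<psi>\<^sub>k'\<rangle> = 0\<close> for every \<open>m\<close>: the derivative of each new mode is orthogonal to the span of
  the old modes. That span contains the new modes, which is the dynamic orthogonality condition.

  To justify these computations, norm convergence must be compatible with sums, scalar multiples
  and inner products (\<open>L2_tendsto_add\<close>, \<open>L2_tendsto_scale\<close>, \<open>L2_tendsto_inner\<close>), which
  yields the product rules \<open>has_L2_derivative_scale\<close> and \<open>has_real_derivative_L2_inner\<close>.
  Since a derivative is determined only almost everywhere, \<open>L2_inner_derivative_unique\<close> carries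
  the orthogonality over from the derivative computed above to the chosen one.
\<close>

section \<open>Square-integrable functions as a semi-inner product space\<close>

lemma L2_mult_integrable:
  assumes "f \<in> L2 M" "g \<in> L2 M"
  shows "integrable M (\<lambda>x. f x * g x)"
proof (rule Bochner_Integration.integrable_bound)
  show "integrable M (\<lambda>x. (f x)\<^sup>2 + (g x)\<^sup>2)"
    using assms by (auto simp: L2_def)
  show "(\<lambda>x. f x * g x) \<in> borel_measurable M"
    using assms by (auto simp: L2_def)
  have "\<bar>a * b\<bar> \<le> a\<^sup>2 + b\<^sup>2" for a b :: real
  proof -
    have "2 * (\<bar>a\<bar> * \<bar>b\<bar>) \<le> a\<^sup>2 + b\<^sup>2"
      using sum_squares_bound[of "\<bar>a\<bar>" "\<bar>b\<bar>"] by simp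
    moreover have "0 \<le> \<bar>a\<bar> * \<bar>b\<bar>" by simp
    ultimately show ?thesis unfolding abs_mult by linarith
  qed
  then show "AE x in M. norm (f x * g x) \<le> norm ((f x)\<^sup>2 + (g x)\<^sup>2)"
    by simp
qed

lemma L2_scale: "f \<in> L2 M \<Longrightarrow> (\<lambda>x. c * f x) \<in> L2 M"
  by (auto simp: L2_def power_mult_distrib)

lemma L2_add:
  assumes "f \<in> L2 M" "g \<in> L2 M"
  shows "(\<lambda>x. f x + g x) \<in> L2 M"
proof -
  have "integrable M (\<lambda>x. (f x)\<^sup>2 + (g x)\<^sup>2 + 2 * (f x * g x))"
    using assms L2_mult_integrable[OF assms] by (auto simp: L2_def)
  then show ?thesis
    using assms by (auto simp: L2_def power2_sum mult.assoc)
qed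

lemma L2_diff:
  assumes "f \<in> L2 M" "g \<in> L2 M"
  shows "(\<lambda>x. f x - g x) \<in> L2 M"
  using L2_add[OF assms(1) L2_scale[OF assms(2), of "-1"]] by simp

lemma L2_sum:
  assumes "\<And>i. i \<in> I \<Longrightarrow> f i \<in> L2 M"
  shows "(\<lambda>x. \<Sum>i\<in>I. f i x) \<in> L2 M"
  using assms
  by (induction I rule: infinite_finite_induct) (auto simp: L2_add, auto simp: L2_def)

lemma L2_inner_commute: "L2_inner M f g = L2_inner M g f"
  by (simp add: L2_inner_def mult.commute)

lemma L2_inner_scale_left: "L2_inner M (\<lambda>x. c * f x) g = c * L2_inner M f g"
  by (simp add: L2_inner_def mult.assoc)

lemma L2_inner_scale_right: "L2_inner M f (\<lambda>x. c * g x) = c * L2_inner M f g"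
  by (simp add: L2_inner_def mult.left_commute)

lemma L2_inner_add_left:
  assumes "f \<in> L2 M" "g \<in> L2 M" "h \<in> L2 M"
  shows "L2_inner M (\<lambda>x. f x + g x) h = L2_inner M f h + L2_inner M g h"
  using assms by (simp add: L2_inner_def distrib_right L2_mult_integrable)

lemma L2_inner_diff_left:
  assumes "f \<in> L2 M" "g \<in> L2 M" "h \<in> L2 M"
  shows "L2_inner M (\<lambda>x. f x - g x) h = L2_inner M f h - L2_inner M g h"
  using assms by (simp add: L2_inner_def left_diff_distrib L2_mult_integrable)

lemma L2_inner_diff_right:
  assumes "f \<in> L2 M" "g \<in> L2 M" "h \<in> L2 M"
  shows "L2_inner M h (\<lambda>x. f x - g x) = L2_inner M h f - L2_inner M h g"
  using L2_inner_diff_left[OF assms] by (simp add: L2_inner_commute)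

lemma L2_inner_sum_left:
  assumes "\<And>i. i \<in> I \<Longrightarrow> f i \<in> L2 M" "h \<in> L2 M"
  shows "L2_inner M (\<lambda>x. \<Sum>i\<in>I. f i x) h = (\<Sum>i\<in>I. L2_inner M (f i) h)"
  using assms by (simp add: L2_inner_def sum_distrib_right L2_mult_integrable)

lemma L2_inner_sum_right:
  assumes "\<And>i. i \<in> I \<Longrightarrow> f i \<in> L2 M" "h \<in> L2 M"
  shows "L2_inner M h (\<lambda>x. \<Sum>i\<in>I. f i x) = (\<Sum>i\<in>I. L2_inner M h (f i))"
  using L2_inner_sum_left[OF assms] by (simp add: L2_inner_commute)

lemma L2_inner_self_nonneg: "0 \<le> L2_inner M f f"
  by (simp add: L2_inner_def)

lemma L2_norm_nonneg: "0 \<le> L2_norm M f"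
  by (simp add: L2_norm_def L2_inner_self_nonneg)

lemma L2_norm_square: "(L2_norm M f)\<^sup>2 = L2_inner M f f"
  by (simp add: L2_norm_def L2_inner_self_nonneg)

lemma L2_norm_scale: "L2_norm M (\<lambda>x. c * f x) = \<bar>c\<bar> * L2_norm M f"
  by (simp add: L2_norm_def L2_inner_scale_left L2_inner_scale_right real_sqrt_mult
      flip: mult.assoc)

text \<open>The quadratic polynomial \<open>t \<mapsto> \<parallel>f - t g\<parallel>\<^sup>2\<close> is nonnegative. If \<open>\<parallel>g\<parallel> > 0\<close>, the claim is
  its value at the minimiser; if \<open>\<parallel>g\<parallel> = 0\<close>, the polynomial is affine and bounded
  below, so its slope vanishes.\<close>

lemma L2_Cauchy_Schwarz:
  assumes f: "f \<in> L2 M" and g: "g \<in> L2 M"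
  shows "\<bar>L2_inner M f g\<bar> \<le> L2_norm M f * L2_norm M g"
proof -
  define a b c where "a = L2_inner M f f" "b = L2_inner M f g" "c = L2_inner M g g"
  have quad: "0 \<le> a - 2 * t * b + t\<^sup>2 * c" for t
  proof -
    have tg: "(\<lambda>x. t * g x) \<in> L2 M" and d: "(\<lambda>x. f x - t * g x) \<in> L2 M"
      using f g by (auto intro: L2_diff L2_scale)
    have "L2_inner M (\<lambda>x. f x - t * g x) (\<lambda>x. f x - t * g x) = a - 2 * t * b + t\<^sup>2 * c"
      using f g tg d
      by (simp add: L2_inner_diff_left L2_inner_diff_right L2_inner_scale_left
          L2_inner_scale_right L2_inner_commute[of M g f] a_b_c_def)
        (simp add: algebra_simps power2_eq_square)
    then show ?thesis
      using L2_inner_self_nonneg by metis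
  qed
  have "b\<^sup>2 \<le> a * c"
  proof (cases "c = 0")
    case True
    have "b = 0"
    proof (rule ccontr)
      assume "b \<noteq> 0"
      \<comment> \<open>At this \<open>t\<close> the affine polynomial takes the value \<open>-1\<close>.\<close>
      then show False
        using quad[of "(a + 1) / (2 * b)"] True by simp
    qed
    then show ?thesis using True by simp
  next
    case False
    then have "c > 0"
      using L2_inner_self_nonneg[of M g] by (simp add: a_b_c_def)
    then show ?thesis
      using quad[of "b / c"] by (simp add: field_simps power2_eq_square)
  qed
  then have "sqrt (b\<^sup>2) \<le> sqrt (a * c)"
    by (rule real_sqrt_le_mono)
  then show ?thesis
    by (simp add: L2_norm_def real_sqrt_mult a_b_c_def)
qed

lemma L2_norm_triangle:
  assumes f: "f \<in> L2 M" and g: "g \<in> L2 M"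
  shows "L2_norm M (\<lambda>x. f x + g x) \<le> L2_norm M f + L2_norm M g"
proof (rule power2_le_imp_le)
  have s: "(\<lambda>x. f x + g x) \<in> L2 M"
    using f g by (rule L2_add)
  have "(L2_norm M (\<lambda>x. f x + g x))\<^sup>2 = (L2_norm M f)\<^sup>2 + 2 * L2_inner M f g + (L2_norm M g)\<^sup>2"
    using L2_inner_add_left[OF f g s] L2_inner_add_left[OF f g f] L2_inner_add_left[OF f g g]
    by (simp add: L2_norm_square L2_inner_commute)
  also have "\<dots> \<le> (L2_norm M f + L2_norm M g)\<^sup>2"
    using L2_Cauchy_Schwarz[OF f g] by (simp add: power2_sum)
  finally show "(L2_norm M (\<lambda>x. f x + g x))\<^sup>2 \<le> (L2_norm M f + L2_norm M g)\<^sup>2" .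
qed (simp add: L2_norm_nonneg)

section \<open>Convergence in norm\<close>

text \<open>Membership of \<open>f s\<close> is required only eventually, because a difference quotient is known to
  be square-integrable only at times of the time set.\<close>

definition L2_tendsto ::
    "'a measure \<Rightarrow> ('b \<Rightarrow> 'a \<Rightarrow> real) \<Rightarrow> ('a \<Rightarrow> real) \<Rightarrow> 'b filter \<Rightarrow> bool" where
  "L2_tendsto M f g F \<longleftrightarrow>
     (\<forall>\<^sub>F s in F. f s \<in> L2 M) \<and> g \<in> L2 M \<and>
     ((\<lambda>s. L2_norm M (\<lambda>x. f s x - g x)) \<longlongrightarrow> 0) F"

lemma L2_tendsto_const: "g \<in> L2 M \<Longrightarrow> L2_tendsto M (\<lambda>s. g) g F"
  by (simp add: L2_tendsto_def L2_norm_def L2_inner_def)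

lemma L2_tendsto_cong:
  assumes "\<forall>\<^sub>F s in F. f s = f' s"
  shows "L2_tendsto M f g F \<longleftrightarrow> L2_tendsto M f' g F"
proof -
  have "(\<forall>\<^sub>F s in F. f s \<in> L2 M) \<longleftrightarrow> (\<forall>\<^sub>F s in F. f' s \<in> L2 M)"
    by (rule eventually_cong[OF assms]) simp
  moreover have "((\<lambda>s. L2_norm M (\<lambda>x. f s x - g x)) \<longlongrightarrow> 0) F \<longleftrightarrow>
      ((\<lambda>s. L2_norm M (\<lambda>x. f' s x - g x)) \<longlongrightarrow> 0) F"
    by (rule tendsto_cong) (use assms in \<open>auto elim: eventually_mono\<close>)
  ultimately show ?thesis by (simp add: L2_tendsto_def)
qed

lemma L2_tendsto_add:
  assumes "L2_tendsto M f f' F" "L2_tendsto M g g' F"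
  shows "L2_tendsto M (\<lambda>s x. f s x + g s x) (\<lambda>x. f' x + g' x) F"
  unfolding L2_tendsto_def
proof (intro conjI)
  note a = assms[unfolded L2_tendsto_def]
  have ev: "\<forall>\<^sub>F s in F. f s \<in> L2 M \<and> g s \<in> L2 M"
    using a by (auto intro: eventually_conj)
  then show "\<forall>\<^sub>F s in F. (\<lambda>x. f s x + g s x) \<in> L2 M"
    by (rule eventually_mono) (auto intro: L2_add)
  show "(\<lambda>x. f' x + g' x) \<in> L2 M"
    using a by (auto intro: L2_add)
  have bound: "\<forall>\<^sub>F s in F. L2_norm M (\<lambda>x. (f s x + g s x) - (f' x + g' x))
      \<le> L2_norm M (\<lambda>x. f s x - f' x) + L2_norm M (\<lambda>x. g s x - g' x)"
    using ev
  proof (rule eventually_mono)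
    fix s assume "f s \<in> L2 M \<and> g s \<in> L2 M"
    then show "L2_norm M (\<lambda>x. (f s x + g s x) - (f' x + g' x))
        \<le> L2_norm M (\<lambda>x. f s x - f' x) + L2_norm M (\<lambda>x. g s x - g' x)"
      using a L2_norm_triangle[of "\<lambda>x. f s x - f' x" M "\<lambda>x. g s x - g' x"]
      by (simp add: L2_diff algebra_simps)
  qed
  show "((\<lambda>s. L2_norm M (\<lambda>x. (f s x + g s x) - (f' x + g' x))) \<longlongrightarrow> 0) F"
    by (rule tendsto_sandwich[OF _ bound tendsto_const])
      (use a in \<open>auto intro: tendsto_add_zero simp: L2_norm_nonneg\<close>)
qed

lemma L2_tendsto_scale:
  assumes c: "(c \<longlongrightarrow> c') F" and f: "L2_tendsto M f f' F"
  shows "L2_tendsto M (\<lambda>s x. c s * f s x) (\<lambda>x. c' * f' x) F"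
  unfolding L2_tendsto_def
proof (intro conjI)
  note f = f[unfolded L2_tendsto_def]
  then show "\<forall>\<^sub>F s in F. (\<lambda>x. c s * f s x) \<in> L2 M" "(\<lambda>x. c' * f' x) \<in> L2 M"
    by (auto intro: L2_scale elim: eventually_mono)
  have bound: "\<forall>\<^sub>F s in F. L2_norm M (\<lambda>x. c s * f s x - c' * f' x)
      \<le> \<bar>c s\<bar> * L2_norm M (\<lambda>x. f s x - f' x) + \<bar>c s - c'\<bar> * L2_norm M f'"
    using f[THEN conjunct1]
  proof (rule eventually_mono)
    fix s assume "f s \<in> L2 M"
    then show "L2_norm M (\<lambda>x. c s * f s x - c' * f' x)
      \<le> \<bar>c s\<bar> * L2_norm M (\<lambda>x. f s x - f' x) + \<bar>c s - c'\<bar> * L2_norm M f'"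
      using f L2_norm_triangle[of "\<lambda>x. c s * (f s x - f' x)" M "\<lambda>x. (c s - c') * f' x"]
      unfolding L2_norm_scale
      by (simp add: L2_diff L2_scale algebra_simps)
  qed
  have "((\<lambda>s. \<bar>c s\<bar> * L2_norm M (\<lambda>x. f s x - f' x) + \<bar>c s - c'\<bar> * L2_norm M f')
      \<longlongrightarrow> \<bar>c'\<bar> * 0 + \<bar>c' - c'\<bar> * L2_norm M f') F"
    using f c by (intro tendsto_intros) auto
  then show "((\<lambda>s. L2_norm M (\<lambda>x. c s * f s x - c' * f' x)) \<longlongrightarrow> 0) F"
    by (intro tendsto_sandwich[OF _ bound tendsto_const]) (auto simp: L2_norm_nonneg)
qed

text \<open>Cauchy--Schwarz applied to
  \<open>\<langle>f\<^sub>s, g\<^sub>s\<rangle> - \<langle>f, g\<rangle> = \<langle>f\<^sub>s - f, g\<^sub>s - g\<rangle> + \<langle>f\<^sub>s - f, g\<rangle> + \<langle>f, g\<^sub>s - g\<rangle>\<close>; this splitting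
  requires no bound on \<open>\<parallel>g\<^sub>s\<parallel>\<close>.\<close>

lemma L2_tendsto_inner:
  assumes "L2_tendsto M f f' F" "L2_tendsto M g g' F"
  shows "((\<lambda>s. L2_inner M (f s) (g s)) \<longlongrightarrow> L2_inner M f' g') F"
proof -
  note a = assms[unfolded L2_tendsto_def]
  define p where "p = (\<lambda>s. L2_norm M (\<lambda>x. f s x - f' x))"
  define q where "q = (\<lambda>s. L2_norm M (\<lambda>x. g s x - g' x))"
  have "\<forall>\<^sub>F s in F. f s \<in> L2 M \<and> g s \<in> L2 M"
    using a by (auto intro: eventually_conj)
  then have "\<forall>\<^sub>F s in F. norm (L2_inner M (f s) (g s) - L2_inner M f' g')
      \<le> p s * q s + p s * L2_norm M g' + L2_norm M f' * q s"
  proof (rule eventually_mono)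
    fix s assume "f s \<in> L2 M \<and> g s \<in> L2 M"
    then have f: "f s \<in> L2 M" "f' \<in> L2 M" "(\<lambda>x. f s x - f' x) \<in> L2 M"
      and g: "g s \<in> L2 M" "g' \<in> L2 M" "(\<lambda>x. g s x - g' x) \<in> L2 M"
      using a by (auto intro: L2_diff)
    have "L2_inner M (f s) (g s) - L2_inner M f' g' =
        L2_inner M (\<lambda>x. f s x - f' x) (\<lambda>x. g s x - g' x)
        + L2_inner M (\<lambda>x. f s x - f' x) g' + L2_inner M f' (\<lambda>x. g s x - g' x)"
      using f g by (simp add: L2_inner_diff_left L2_inner_diff_right)
    then show "norm (L2_inner M (f s) (g s) - L2_inner M f' g')
      \<le> p s * q s + p s * L2_norm M g' + L2_norm M f' * q s"
      using L2_Cauchy_Schwarz[OF f(3) g(3)] L2_Cauchy_Schwarz[OF f(3) g(2)]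
        L2_Cauchy_Schwarz[OF f(2) g(3)]
      unfolding p_def q_def real_norm_def by linarith
  qed
  moreover have "((\<lambda>s. p s * q s + p s * L2_norm M g' + L2_norm M f' * q s) \<longlongrightarrow> 0) F"
  proof -
    have "(p \<longlongrightarrow> 0) F" "(q \<longlongrightarrow> 0) F"
      using a by (simp_all add: p_def q_def)
    then show ?thesis
      by (intro tendsto_add_zero tendsto_mult_zero tendsto_mult_left_zero tendsto_mult_right_zero)
  qed
  ultimately have "((\<lambda>s. L2_inner M (f s) (g s) - L2_inner M f' g') \<longlongrightarrow> 0) F"
    by (rule Lim_null_comparison)
  then show ?thesis by (rule LIM_zero_cancel)
qed

section \<open>Calculus of derivatives in norm\<close>

lemma has_L2_derivative_iff_tendsto:
  assumes "t \<in> T"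
  shows "has_L2_derivative M T u v t \<longleftrightarrow>
     (\<forall>s\<in>T. u s \<in> L2 M) \<and> L2_tendsto M (\<lambda>s x. (u s x - u t x) / (s - t)) v (at t within T)"
proof -
  have "\<forall>\<^sub>F s in at t within T. (\<lambda>x. (u s x - u t x) / (s - t)) \<in> L2 M"
    if "\<forall>s\<in>T. u s \<in> L2 M"
  proof -
    have "(\<lambda>x. (u s x - u t x) / (s - t)) \<in> L2 M" if "s \<in> T" for s
      using L2_scale[OF L2_diff, of "u s" M "u t" "inverse (s - t)"] that assms
        \<open>\<forall>s\<in>T. u s \<in> L2 M\<close> by (simp add: divide_inverse mult.commute)
    then show ?thesis by (auto simp: eventually_at_filter)
  qed
  then show ?thesis by (auto simp: has_L2_derivative_def L2_tendsto_def)
qed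

lemma has_L2_derivative_imp_L2_tendsto:
  assumes t: "t \<in> T" and u: "has_L2_derivative M T u v t"
  shows "L2_tendsto M u (u t) (at t within T)"
proof -
  note q = u[unfolded has_L2_derivative_iff_tendsto[OF t]]
  have "((\<lambda>s. s - t) \<longlongrightarrow> t - t) (at t within T)"
    by (intro tendsto_intros)
  then have "L2_tendsto M (\<lambda>s x. u t x + (s - t) * ((u s x - u t x) / (s - t)))
      (\<lambda>x. u t x + (t - t) * v x) (at t within T)"
    using q t by (intro L2_tendsto_add L2_tendsto_const L2_tendsto_scale) auto
  moreover have "\<forall>\<^sub>F s in at t within T.
      (\<lambda>x. u t x + (s - t) * ((u s x - u t x) / (s - t))) = u s"
    by (auto simp: eventually_at_filter)
  ultimately show ?thesis
    using L2_tendsto_cong by fastforce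
qed

lemma has_L2_derivative_zero: "has_L2_derivative M T (\<lambda>s x. 0) (\<lambda>x. 0) t"
  by (simp add: has_L2_derivative_def L2_norm_def L2_inner_def) (simp add: L2_def)

lemma has_L2_derivative_add:
  assumes t: "t \<in> T" and "has_L2_derivative M T u u' t" "has_L2_derivative M T w w' t"
  shows "has_L2_derivative M T (\<lambda>s x. u s x + w s x) (\<lambda>x. u' x + w' x) t"
proof -
  note a = assms(2,3)[unfolded has_L2_derivative_iff_tendsto[OF t]]
  have "L2_tendsto M (\<lambda>s x. (u s x - u t x) / (s - t) + (w s x - w t x) / (s - t))
      (\<lambda>x. u' x + w' x) (at t within T)"
    using a by (intro L2_tendsto_add) auto
  moreover have "(\<lambda>s x. (u s x - u t x) / (s - t) + (w s x - w t x) / (s - t)) =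
      (\<lambda>s x. ((u s x + w s x) - (u t x + w t x)) / (s - t))"
    by (simp add: add_diff_add flip: add_divide_distrib)
  ultimately show ?thesis
    unfolding has_L2_derivative_iff_tendsto[OF t] using a by (auto intro: L2_add)
qed

lemma has_L2_derivative_sum:
  assumes t: "t \<in> T" and "\<And>i. i \<in> I \<Longrightarrow> has_L2_derivative M T (u i) (u' i) t"
  shows "has_L2_derivative M T (\<lambda>s x. \<Sum>i\<in>I. u i s x) (\<lambda>x. \<Sum>i\<in>I. u' i x) t"
  using assms(2)
  by (induction I rule: infinite_finite_induct)
    (auto simp: has_L2_derivative_zero has_L2_derivative_add[OF t])

lemma has_L2_derivative_scale:
  assumes t: "t \<in> T" and c: "(c has_real_derivative c') (at t within T)"
    and u: "has_L2_derivative M T u u' t"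
  shows "has_L2_derivative M T (\<lambda>s x. c s * u s x) (\<lambda>x. c t * u' x + c' * u t x) t"
proof -
  note a = u[unfolded has_L2_derivative_iff_tendsto[OF t]]
  have "(c \<longlongrightarrow> c t) (at t within T)"
    using DERIV_continuous[OF c] by (simp add: continuous_within)
  moreover have "((\<lambda>s. (c s - c t) / (s - t)) \<longlongrightarrow> c') (at t within T)"
    using c by (simp add: has_field_derivative_iff)
  ultimately have "L2_tendsto M
      (\<lambda>s x. c s * ((u s x - u t x) / (s - t)) + (c s - c t) / (s - t) * u t x)
      (\<lambda>x. c t * u' x + c' * u t x) (at t within T)"
    using a t by (intro L2_tendsto_add L2_tendsto_scale L2_tendsto_const) auto
  moreover have "(\<lambda>s x. c s * ((u s x - u t x) / (s - t)) + (c s - c t) / (s - t) * u t x) =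
      (\<lambda>s x. (c s * u s x - c t * u t x) / (s - t))"
    by (simp add: algebra_simps flip: add_divide_distrib diff_divide_distrib)
  ultimately show ?thesis
    unfolding has_L2_derivative_iff_tendsto[OF t] using a by (auto intro: L2_scale)
qed

lemma has_real_derivative_L2_inner:
  assumes t: "t \<in> T" and u: "has_L2_derivative M T u u' t" and w: "has_L2_derivative M T w w' t"
  shows "((\<lambda>s. L2_inner M (u s) (w s)) has_real_derivative
      L2_inner M u' (w t) + L2_inner M (u t) w') (at t within T)"
proof -
  note a = u[unfolded has_L2_derivative_iff_tendsto[OF t]]
  note b = w[unfolded has_L2_derivative_iff_tendsto[OF t]]
  have "((\<lambda>s. L2_inner M (\<lambda>x. (u s x - u t x) / (s - t)) (w s)
      + L2_inner M (u t) (\<lambda>x. (w s x - w t x) / (s - t)))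
      \<longlongrightarrow> L2_inner M u' (w t) + L2_inner M (u t) w') (at t within T)"
    using a b t has_L2_derivative_imp_L2_tendsto[OF t w]
    by (intro tendsto_add L2_tendsto_inner L2_tendsto_const) auto
  moreover have "L2_inner M (\<lambda>x. (u s x - u t x) / (s - t)) (w s)
      + L2_inner M (u t) (\<lambda>x. (w s x - w t x) / (s - t))
      = (L2_inner M (u s) (w s) - L2_inner M (u t) (w t)) / (s - t)" if s: "s \<in> T" for s
  proof -
    have m: "u s \<in> L2 M" "u t \<in> L2 M" "w s \<in> L2 M" "w t \<in> L2 M"
      using a b s t by auto
    show ?thesis
      unfolding divide_inverse mult.commute[of _ "inverse (s - t)"]
        L2_inner_scale_left L2_inner_scale_right
      using m by (simp add: L2_inner_diff_left L2_inner_diff_right algebra_simps)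
  qed
  then have "\<forall>\<^sub>F s in at t within T. L2_inner M (\<lambda>x. (u s x - u t x) / (s - t)) (w s)
      + L2_inner M (u t) (\<lambda>x. (w s x - w t x) / (s - t))
      = (L2_inner M (u s) (w s) - L2_inner M (u t) (w t)) / (s - t)"
    by (simp add: eventually_at_filter)
  ultimately show ?thesis
    unfolding has_field_derivative_iff by (rule Lim_transform_eventually)
qed

text \<open>Derivatives in norm are unique only almost everywhere, so pairing with a fixed test
  function is what makes them comparable: both pairings are the derivative of the same
  scalar function.\<close>

lemma L2_inner_derivative_unique:
  assumes t: "t \<in> T" "at t within T \<noteq> bot"
    and v: "has_L2_derivative M T u v t" and w: "has_L2_derivative M T u w t"
    and g: "g \<in> L2 M"
  shows "L2_inner M v g = L2_inner M w g"
proof -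
  have lim: "((\<lambda>s. L2_inner M (\<lambda>x. (u s x - u t x) / (s - t)) g) \<longlongrightarrow> L2_inner M v' g)
      (at t within T)" if "has_L2_derivative M T u v' t" for v'
    using that g unfolding has_L2_derivative_iff_tendsto[OF t(1)]
    by (intro L2_tendsto_inner L2_tendsto_const) simp_all
  show ?thesis
    by (rule tendsto_unique[OF t(2) lim[OF v] lim[OF w]])
qed

lemma L2_deriv_works:
  "L2_differentiable M T u t \<Longrightarrow> has_L2_derivative M T u (L2_deriv M T u t) t"
  unfolding L2_differentiable_def L2_deriv_def by (erule someI_ex)

lemma at_within_halfline_neq_bot:
  fixes t :: real
  assumes "t \<ge> 0"
  shows "at t within {0..} \<noteq> bot"
proof -
  have "at_right t \<le> at t within {0..}"
    using assms by (intro at_le) auto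
  then show ?thesis
    using trivial_limit_at_right_real[of t] by (metis bot_unique)
qed

section \<open>Diagonal powers and skew-symmetric flows\<close>

lemma diag_powr_mult_nth: "(diag_powr A s ** B) $ i $ k = (A $ i $ i) powr s * B $ i $ k"
  by (simp add: matrix_matrix_mult_def diag_powr_def if_distrib[of "\<lambda>a. a * _"] cong: if_cong)

lemma mult_diag_powr_nth: "(B ** diag_powr A s) $ i $ k = B $ i $ k * (A $ k $ k) powr s"
  by (simp add: matrix_matrix_mult_def diag_powr_def if_distrib[of "\<lambda>a. _ * a"] cong: if_cong)

lemma invertible_diag_powr:
  fixes A :: "real ^ 'r ^ 'r"
  assumes "\<And>i. A $ i $ i > 0"
  shows "invertible (diag_powr A s)"
proof -
  have "diag_powr A a ** diag_powr A (- a) = mat 1" for a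
  proof -
    have "A $ i $ i powr a * A $ i $ i powr (- a) = 1" for i
      using assms[of i] by (simp flip: powr_add)
    then show ?thesis
      by (simp add: vec_eq_iff diag_powr_mult_nth) (simp add: diag_powr_def mat_def)
  qed
  from this[of s] this[of "- s"] show ?thesis
    by (auto simp: invertible_def)
qed

lemma has_real_derivative_matrix_nth:
  fixes P :: "real \<Rightarrow> real ^ 'r::finite ^ 'r"
  assumes "(P has_vector_derivative D) F"
  shows "((\<lambda>s. P s $ i $ k) has_real_derivative D $ i $ k) F"
  using bounded_linear.has_vector_derivative[OF
      bounded_linear_compose[OF bounded_linear_vec_nth bounded_linear_vec_nth] assms]
  by (simp add: has_real_derivative_iff_has_vector_derivative)

text \<open>For a skew-symmetric generator \<open>A\<close>, the flow \<open>P' = - A P\<close> gives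
  \<open>(P\<^sup>T P)' = - P\<^sup>T (A\<^sup>T + A) P = 0\<close>, so \<open>P\<^sup>T P\<close> keeps its initial value.\<close>

lemma skew_flow_orthogonal_matrix:
  fixes P A :: "real \<Rightarrow> real ^ 'r::finite ^ 'r"
  assumes ode: "\<And>t. t \<ge> 0 \<Longrightarrow> (P has_vector_derivative - (A t ** P t)) (at t within {0..})"
    and init: "P 0 = mat 1"
    and skew: "\<And>t i k. t \<ge> 0 \<Longrightarrow> A t $ i $ k = - A t $ k $ i"
    and t: "t \<ge> 0"
  shows "orthogonal_matrix (P t)"
proof -
  have "(transpose (P t) ** P t) $ k $ l = (mat 1 :: real ^ 'r ^ 'r) $ k $ l" for k l
  proof -
    define G where "G = (\<lambda>s. \<Sum>i\<in>UNIV. P s $ i $ k * P s $ i $ l)"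
    have "(G has_real_derivative 0) (at s within {0..})" if s: "s \<in> {0..}" for s
    proof -
      define Q where "Q = A s ** P s"
      have dP: "((\<lambda>s. P s $ i $ m) has_real_derivative - (Q $ i $ m)) (at s within {0..})" for i m
        using has_real_derivative_matrix_nth[OF ode, of s i m] s by (simp add: Q_def)
      have "(G has_real_derivative
          (\<Sum>i\<in>UNIV. - (Q $ i $ k) * P s $ i $ l + - (Q $ i $ l) * P s $ i $ k))
          (at s within {0..})"
        unfolding G_def by (intro DERIV_sum DERIV_mult dP)
      moreover have "(\<Sum>i\<in>UNIV. Q $ i $ k * P s $ i $ l) = - (\<Sum>i\<in>UNIV. Q $ i $ l * P s $ i $ k)"
      proof -
        have "(\<Sum>i\<in>UNIV. Q $ i $ k * P s $ i $ l) =
            (\<Sum>i\<in>UNIV. \<Sum>m\<in>UNIV. A s $ i $ m * P s $ m $ k * P s $ i $ l)"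
          by (simp add: Q_def matrix_matrix_mult_def sum_distrib_right)
        also have "\<dots> = (\<Sum>m\<in>UNIV. \<Sum>i\<in>UNIV. A s $ i $ m * P s $ m $ k * P s $ i $ l)"
          by (rule sum.swap)
        also have "\<dots> = (\<Sum>m\<in>UNIV. \<Sum>i\<in>UNIV. - (A s $ m $ i * P s $ i $ l * P s $ m $ k))"
          using s by (intro sum.cong refl) (subst skew, auto)
        also have "\<dots> = - (\<Sum>i\<in>UNIV. Q $ i $ l * P s $ i $ k)"
          by (simp add: Q_def matrix_matrix_mult_def sum_distrib_right sum_negf)
        finally show ?thesis .
      qed
      ultimately show ?thesis
        by (simp add: sum.distrib sum_negf sum_subtractf)
    qed
    then obtain c where "\<And>s. s \<in> {0..} \<Longrightarrow> G s = c"
      using has_field_derivative_zero_constant[of "{0..}" G] by auto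
    then have "G t = G 0"
      using t by simp
    then show ?thesis
      by (simp add: G_def init matrix_matrix_mult_def transpose_def mat_def
          if_distrib[of "\<lambda>a. a * _"] cong: if_cong)
  qed
  then have "transpose (P t) ** P t = mat 1"
    by (simp add: vec_eq_iff)
  then show ?thesis by (simp add: orthogonal_matrix)
qed

section \<open>Dynamic orthogonality of the transformed modes\<close>

theorem theorem3p1:
  fixes d j :: nat
    and \<Omega> :: "nat \<Rightarrow> real set"
    and \<phi> :: "'r::finite \<Rightarrow> real \<Rightarrow> real \<Rightarrow> real"
    and \<phi>t :: "'r \<Rightarrow> real \<Rightarrow> (nat \<Rightarrow> real) \<Rightarrow> real"
    and lam :: "'r \<Rightarrow> real \<Rightarrow> real"
    and M :: "real measure" and N :: "(nat \<Rightarrow> real) measure"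
    and \<Lambda> S P :: "real \<Rightarrow> real ^ 'r ^ 'r"
    and \<psi> :: "'r \<Rightarrow> real \<Rightarrow> real \<Rightarrow> real"
    and \<psi>t :: "'r \<Rightarrow> real \<Rightarrow> (nat \<Rightarrow> real) \<Rightarrow> real"
  assumes level: "1 \<le> j" "j < d"
    and domains: "\<And>i. i \<in> {1..d} \<Longrightarrow> is_interval (\<Omega> i) \<and> interior (\<Omega> i) \<noteq> {}"
    and M: "M = domain_measure \<Omega> j"
    and N: "N = tail_measure \<Omega> j d"
    and modes: "\<And>k t. t \<ge> 0 \<Longrightarrow> \<phi> k t \<in> L2 M" "\<And>k t. t \<ge> 0 \<Longrightarrow> \<phi>t k t \<in> L2 N"
    and C1: "\<And>k. L2_C1_on M {0..} (\<phi> k)" "\<And>k. L2_C1_on N {0..} (\<phi>t k)"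
    and BO: "\<And>k p t. t \<ge> 0 \<Longrightarrow> L2_inner M (\<phi> k t) (\<phi> p t) = (if k = p then lam k t else 0)"
            "\<And>k p t. t \<ge> 0 \<Longrightarrow> L2_inner N (\<phi>t k t) (\<phi>t p t) = (if k = p then 1 else 0)"
    and lam_pos: "\<And>k t. t \<ge> 0 \<Longrightarrow> lam k t > 0"
    and Lambda: "\<And>t. \<Lambda> t = gram_matrix M (\<lambda>k. \<phi> k t)"
    and Sigma: "\<And>t. S t = sigma_matrix M \<phi> t"
    and P_ode: "\<And>t. t \<ge> 0 \<Longrightarrow>
          (P has_vector_derivative
             - (diag_powr (\<Lambda> t) (-1/2) ** S t ** diag_powr (\<Lambda> t) (-1/2) ** P t))
          (at t within {0..})"
    and P_init: "P 0 = mat 1"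
    and psi: "\<And>k t. \<psi> k t = row_times (\<lambda>i. \<phi> i t) (diag_powr (\<Lambda> t) (-1/2) ** P t) k"
    and psit: "\<And>k t. \<psi>t k t = row_times (\<lambda>i. \<phi>t i t) (diag_powr (\<Lambda> t) (1/2) ** P t) k"
  shows "\<forall>t\<ge>0.
      invertible (diag_powr (\<Lambda> t) (-1/2) ** P t) \<and>
      invertible (diag_powr (\<Lambda> t) (1/2) ** P t) \<and>
      L2_orthonormal M (\<lambda>k. \<psi> k t) \<and>
      (\<forall>x\<in>space M. \<forall>y\<in>space N.
         (\<Sum>k\<in>UNIV. \<psi> k t x * \<psi>t k t y) = (\<Sum>k\<in>UNIV. \<phi> k t x * \<phi>t k t y)) \<and>
      (\<forall>i. L2_differentiable M {0..} (\<psi> i) t) \<and>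
      (\<forall>i k. L2_inner M (L2_deriv M {0..} (\<psi> i) t) (\<psi> k t) = 0)"
proof -
  define \<phi>' where "\<phi>' = (\<lambda>k. L2_deriv M {0..} (\<phi> k))"
  define b where "b = (\<lambda>t i k. L2_inner M (\<phi> i t) (\<phi>' k t))"
  have d\<phi>: "has_L2_derivative M {0..} (\<phi> k) (\<phi>' k t) t" if "t \<ge> 0" for k t
    using C1(1)[of k] that L2_deriv_works unfolding L2_C1_on_def \<phi>'_def by fastforce
  have \<phi>'_L2: "\<phi>' k t \<in> L2 M" if "t \<ge> 0" for k t
    using d\<phi>[OF that] by (simp add: has_L2_derivative_def)
  have \<Lambda>_nth: "\<Lambda> t $ i $ k = L2_inner M (\<phi> i t) (\<phi> k t)" for t i k
    by (simp add: Lambda gram_matrix_def)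
  have \<Lambda>_diag: "\<Lambda> t $ i $ i = lam i t" if "t \<ge> 0" for t i
    using BO(1)[OF that] by (simp add: \<Lambda>_nth)
  have \<Lambda>_pos: "\<Lambda> t $ i $ i > 0" if "t \<ge> 0" for t i
    using \<Lambda>_diag lam_pos that by simp
  have S_nth: "S t $ i $ k = (if i = k then 0 else b t i k)" for t i k
    by (simp add: Sigma sigma_matrix_def b_def \<phi>'_def)
  have d\<Lambda>: "((\<lambda>s. \<Lambda> s $ i $ k) has_real_derivative b t k i + b t i k) (at t within {0..})"
    if "t \<ge> 0" for t i k
    using has_real_derivative_L2_inner[OF _ d\<phi>[OF that] d\<phi>[OF that], of i k] that
    by (simp add: \<Lambda>_nth b_def L2_inner_commute)

  \<comment> \<open>Off the diagonal the Gram matrix vanishes identically, hence so does its derivative.\<close>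
  have b_skew: "b t k i + b t i k = 0" if t: "t \<ge> 0" and ik: "i \<noteq> k" for t i k
  proof -
    have "((\<lambda>s. \<Lambda> s $ i $ k) has_real_derivative 0) (at t within {0..})"
      by (rule has_field_derivative_transform_within[OF DERIV_const[of 0] zero_less_one])
        (use BO(1) ik t in \<open>auto simp: \<Lambda>_nth\<close>)
    then show ?thesis
      using vector_derivative_unique_within[OF at_within_halfline_neq_bot[OF t]] d\<Lambda>[OF t]
      unfolding has_real_derivative_iff_has_vector_derivative by blast
  qed
  define A where "A = (\<lambda>t. diag_powr (\<Lambda> t) (-1/2) ** S t ** diag_powr (\<Lambda> t) (-1/2))"
  have "A t $ i $ k = - A t $ k $ i" if "t \<ge> 0" for t i k
    using b_skew[OF that, of i k]
    by (simp add: A_def mult_diag_powr_nth diag_powr_mult_nth S_nth add_eq_0_iff)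
  moreover have "(P has_vector_derivative - (A t ** P t)) (at t within {0..})" if "t \<ge> 0" for t
    using P_ode[OF that] by (simp add: A_def)
  ultimately have orth: "orthogonal_matrix (P t)" if "t \<ge> 0" for t
    using skew_flow_orthogonal_matrix[where P = P and A = A and t = t] P_init that by blast

  define C where "C = (\<lambda>i k s. (\<Lambda> s $ i $ i) powr (-1/2) * P s $ i $ k)"
  have \<psi>_eq: "\<psi> k = (\<lambda>s x. \<Sum>i\<in>UNIV. C i k s * \<phi> i s x)" for k
    by (intro ext) (simp add: psi row_times_def diag_powr_mult_nth C_def mult.commute)
  define C' where "C' = (\<lambda>m k t. - (\<Sum>i\<in>UNIV. b t m i * C i k t) / lam m t)"

  \<comment> \<open>The value of \<open>C'\<close> is the one that makes \<open>\<psi>'\<close> orthogonal to every \<open>\<phi>\<^sub>m\<close>.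
    The derivative of \<open>\<lambda>\<^sub>m\<^sup>-\<^sup>1\<^sup>/\<^sup>2\<close> contributes the diagonal term \<open>i = m\<close>, and the
    differential equation for \<open>P\<close> the terms \<open>i \<noteq> m\<close>.\<close>
  have dC: "(C m k has_real_derivative C' m k t) (at t within {0..})" if t: "t \<ge> 0" for m k t
  proof -
    define l where "l = lam m t"
    have l: "l > 0" using lam_pos[OF t] by (simp add: l_def)
    have powr: "l powr (-1/2) * l powr (-1/2) = 1 / l"
      "l powr (-1/2 - 1) = l powr (-1/2) / l"
      using l powr_diff[of l "-1/2" 1] by (simp_all add: powr_minus_divide flip: powr_add)
    define Q where "Q = (\<Sum>i\<in>UNIV. S t $ m $ i * C i k t)"
    define B where "B = diag_powr (\<Lambda> t) (-1/2) ** P t"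
    have "(S t ** B) $ m $ k = Q"
      unfolding Q_def matrix_matrix_mult_def[of "S t" B]
      by (simp add: B_def C_def diag_powr_mult_nth)
    moreover have "A t ** P t = diag_powr (\<Lambda> t) (-1/2) ** (S t ** B)"
      by (simp only: A_def B_def matrix_mul_assoc)
    ultimately have "(A t ** P t) $ m $ k = l powr (-1/2) * Q"
      by (simp only: diag_powr_mult_nth l_def \<Lambda>_diag[OF t])
    then have dP: "((\<lambda>s. P s $ m $ k) has_real_derivative - (l powr (-1/2) * Q)) (at t within {0..})"
      using has_real_derivative_matrix_nth[OF P_ode[OF t], of m k] by (simp add: A_def)
    have "((\<lambda>s. (\<Lambda> s $ m $ m) powr (-1/2)) has_real_derivative
        (-1/2) * l powr (-1/2 - 1) * (2 * b t m m)) (at t within {0..})"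
      using DERIV_chain2[OF has_real_derivative_powr d\<Lambda>[OF t, of m m], of "-1/2"] \<Lambda>_pos[OF t, of m]
      by (simp add: \<Lambda>_diag[OF t] l_def)
    from DERIV_mult[OF this dP] have
      "(C m k has_real_derivative
        (-1/2) * l powr (-1/2 - 1) * (2 * b t m m) * P t $ m $ k
        + - (l powr (-1/2) * Q) * l powr (-1/2)) (at t within {0..})"
      by (simp add: C_def \<Lambda>_diag[OF t] l_def)
    moreover have sum: "(\<Sum>i\<in>UNIV. b t m i * C i k t) = b t m m * C m k t + Q"
    proof -
      have "(\<Sum>i\<in>UNIV. b t m i * C i k t)
          = (\<Sum>i\<in>UNIV. (if i = m then b t m m * C m k t else 0) + S t $ m $ i * C i k t)"
        by (intro sum.cong) (auto simp: S_nth)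
      then show ?thesis by (simp add: sum.distrib Q_def)
    qed
    have "C' m k t = (-1/2) * l powr (-1/2 - 1) * (2 * b t m m) * P t $ m $ k
        + - (l powr (-1/2) * Q) * l powr (-1/2)"
    proof -
      have "(l powr (-1/2) * Q) * l powr (-1/2) = Q / l"
        using powr(1) by (metis (no_types) mult.commute mult.left_commute mult_1 times_divide_eq_right)
      moreover have "C m k t = l powr (-1/2) * P t $ m $ k"
        by (simp add: C_def \<Lambda>_diag[OF t] l_def)
      ultimately show ?thesis
        unfolding C'_def sum powr(2) l_def[symmetric] by (simp add: diff_divide_distrib mult_ac)
    qed
    ultimately show ?thesis by simp
  qed
  define \<psi>' where "\<psi>' = (\<lambda>k t x. \<Sum>i\<in>UNIV. C i k t * \<phi>' i t x + C' i k t * \<phi> i t x)"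
  have d\<psi>: "has_L2_derivative M {0..} (\<psi> k) (\<psi>' k t) t" if "t \<ge> 0" for k t
    unfolding \<psi>_eq \<psi>'_def
    using that by (intro has_L2_derivative_sum has_L2_derivative_scale dC d\<phi>) auto
  have \<psi>'_perp: "L2_inner M (\<psi>' k t) (\<phi> m t) = 0" if t: "t \<ge> 0" for k m t
  proof -
    have "L2_inner M (\<psi>' k t) (\<phi> m t) = (\<Sum>i\<in>UNIV. C i k t * b t m i
        + (if i = m then C' i k t * lam m t else 0))"
      unfolding \<psi>'_def using \<phi>'_L2[OF t] modes(1)[OF t] BO(1)[OF t]
      by (subst L2_inner_sum_left)
        (auto simp: L2_add L2_scale L2_inner_add_left L2_inner_scale_left b_def
          L2_inner_commute[of M "\<phi> m t"] intro!: sum.cong)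
    also have "\<dots> = (\<Sum>i\<in>UNIV. b t m i * C i k t) + C' m k t * lam m t"
      by (simp add: sum.distrib mult.commute)
    also have "\<dots> = 0"
      using lam_pos[OF t, of m] by (simp add: C'_def)
    finally show ?thesis .
  qed

  show ?thesis
  proof (intro allI impI conjI ballI)
    fix t :: real assume t: "t \<ge> 0"
    have "invertible (P t)"
      using orth[OF t] by (auto simp: orthogonal_matrix_def invertible_def)
    then show "invertible (diag_powr (\<Lambda> t) (-1/2) ** P t)"
      "invertible (diag_powr (\<Lambda> t) (1/2) ** P t)"
      using \<Lambda>_pos[OF t] by (intro invertible_mult invertible_diag_powr; simp)+
    have \<psi>_L2: "\<psi> k t \<in> L2 M" for k
      unfolding \<psi>_eq by (intro L2_sum L2_scale modes(1)[OF t])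
    have inner_\<psi>: "L2_inner M g (\<psi> k t) = (\<Sum>i\<in>UNIV. C i k t * L2_inner M g (\<phi> i t))"
      if "g \<in> L2 M" for g k
      using that modes(1)[OF t]
      by (simp add: \<psi>_eq L2_inner_sum_right L2_scale L2_inner_scale_right)
    show "L2_orthonormal M (\<lambda>k. \<psi> k t)"
      unfolding L2_orthonormal_def
    proof (intro conjI allI)
      fix k p
      have \<phi>\<psi>: "L2_inner M (\<phi> i t) (\<psi> p t) = C i p t * lam i t" for i
        by (simp add: inner_\<psi> modes(1)[OF t] BO(1)[OF t] if_distrib[of "\<lambda>a. _ * a"] cong: if_cong)
      have CC: "C i k t * (C i p t * lam i t) = P t $ i $ k * P t $ i $ p" for i
      proof -
        have "lam i t powr (-1/2) * lam i t powr (-1/2) * lam i t = 1"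
          using lam_pos[OF t, of i] by (simp add: powr_minus_divide flip: powr_add)
        then show ?thesis
          by (simp add: C_def \<Lambda>_diag[OF t])
      qed
      have "L2_inner M (\<psi> k t) (\<psi> p t) = L2_inner M (\<psi> p t) (\<psi> k t)"
        by (rule L2_inner_commute)
      also have "\<dots> = (\<Sum>i\<in>UNIV. P t $ i $ k * P t $ i $ p)"
        unfolding inner_\<psi>[OF \<psi>_L2] L2_inner_commute[of M "\<psi> p t"] \<phi>\<psi> CC ..
      also have "\<dots> = (transpose (P t) ** P t) $ k $ p"
        by (simp add: matrix_matrix_mult_def transpose_def)
      also have "\<dots> = (if k = p then 1 else 0)"
        using orth[OF t] by (simp add: orthogonal_matrix_def mat_def)
      finally show "L2_inner M (\<psi> k t) (\<psi> p t) = (if k = p then 1 else 0)" .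
    qed (rule \<psi>_L2)
    show "L2_differentiable M {0..} (\<psi> i) t" for i
      using d\<psi>[OF t] by (auto simp: L2_differentiable_def)
    then have D: "has_L2_derivative M {0..} (\<psi> i) (L2_deriv M {0..} (\<psi> i) t) t" for i
      by (rule L2_deriv_works)
    then have "L2_inner M (L2_deriv M {0..} (\<psi> i) t) (\<phi> m t) = 0" for i m
      using L2_inner_derivative_unique[OF _ at_within_halfline_neq_bot[OF t] D d\<psi>[OF t]
          modes(1)[OF t], of i m] \<psi>'_perp[OF t] t by simp
    then show "L2_inner M (L2_deriv M {0..} (\<psi> i) t) (\<psi> k t) = 0" for i k
      using D[of i] by (simp add: inner_\<psi> has_L2_derivative_def)
    fix x y
    have "(\<Sum>k\<in>UNIV. \<psi> k t x * \<psi>t k t y)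
        = (\<Sum>k\<in>UNIV. \<Sum>i\<in>UNIV. \<Sum>m\<in>UNIV. \<phi> i t x * lam i t powr (-1/2) *
            (\<phi>t m t y * lam m t powr (1/2)) * (P t $ i $ k * P t $ m $ k))"
      by (simp add: psi psit row_times_def diag_powr_mult_nth \<Lambda>_diag[OF t] sum_product)
        (simp only: mult_ac)
    also have "\<dots> = (\<Sum>i\<in>UNIV. \<Sum>m\<in>UNIV. \<phi> i t x * lam i t powr (-1/2) *
            (\<phi>t m t y * lam m t powr (1/2)) * (P t ** transpose (P t)) $ i $ m)"
      by (subst sum.swap, rule sum.cong[OF refl], subst sum.swap)
        (simp add: matrix_matrix_mult_def transpose_def sum_distrib_left)
    also have "\<dots> = (\<Sum>i\<in>UNIV. \<phi> i t x * \<phi>t i t y * (lam i t powr (-1/2) * lam i t powr (1/2)))"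
      using orth[OF t]
      by (simp add: orthogonal_matrix_def mat_def if_distrib[of "\<lambda>a. _ * a"] cong: if_cong)
        (simp only: mult_ac)
    also have "\<dots> = (\<Sum>k\<in>UNIV. \<phi> k t x * \<phi>t k t y)"
      using lam_pos[OF t] by (simp add: less_imp_neq[symmetric] flip: powr_add)
    finally show "(\<Sum>k\<in>UNIV. \<psi> k t x * \<psi>t k t y) = (\<Sum>k\<in>UNIV. \<phi> k t x * \<phi>t k t y)" .
  qed
qed

end
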